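(* Consider $\min_{x\in\mathbb{R}^d}f(x)$ with nonempty set of optimal solutions $\mathcal{X}^*$ and optimal value $f^*$. Suppose that $f$ has the finite-sum structure $f(x)=\frac1n\sum_{i=1}^nf_i(x)$ with each $f_i:\mathbb{R}^d\to\mathbb{R}$ being convex. Suppose further that $f$ satisfies the interpolation condition, i.e., $\min_{x\in\mathbb{R}^d}f_i(x)=f_i(x^* )$ for each $i$, where $x^*\in\mathcal{X}^*$ is a minimizer of $f$. Let the iterates be generated from an initial point $x^0$ by the stochastic subgradient method: in the $k$-th iteration, sample $i_k$ from $\{1,\ldots,n\}$ uniformly at random and set $x^{k+1}=x^k-\alpha_kg_{i_k}(x^k)$ with $g_{i_k}(x^k)\in\partial f_{i_k}(x^k)$, where the step sizes $\{\alpha_k\}_{k=0}^T$ satisfy $$\alpha_k=\frac{\beta_k}{\|g_{i_k}(x^k)\|}\quad\text{with}\quad\beta_k=\frac{c}{\sqrt{T+1}}\quad\text{for }k=0,1,\ldots,T,$$ $c>0$ is some constant, and $T$ is the pre-determined total number of iterations. Let $\tilde x^T=\frac1{T+1}\sum_{k=0}^Tx^k$ and let $x^*\in\mathcal{X}^*$ be some fixed optimal solution. Then $$\mathbb{E}\left[f(\tilde x^T)-f^*\right]\le\frac{L_{\mathcal{A}'}\left(\|x^0-x^*\|^2/c+c\right)}{2\sqrt{T+1}},$$ where $L_{\mathcal{A}'}>0$ is the Lipschitz constant of $f$ on $\mathcal{A}'$, and $\mathcal{A}'$ is any bounded open convex set that contains the ball $\mathcal{A}:=\{x\in\mathbb{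R}^d:\|x-x^*\|^2\le\|x^0-x^*\|^2+c^2\}$.
   Context: $\|\cdot\|$ is the Euclidean norm; for a convex function $h$, $\partial h(x)=\{g\in\mathbb{R}^d:h(y)\ge h(x)+\langle g,y-x\rangle\ \forall y\in\mathbb{R}^d\}$. The stochastic subgradient $g_{i_k}(x^k)$ satisfies $\mathbb{E}_{i_k}[g_{i_k}(x^k)]\in\partial f(x^k)$, and the realizations $i_0,i_1,\ldots$ are assumed independent of each other. The expectation is over the random indices. The interpolation condition implies that each component function shares the same minimizers as $f$. $f$ is not assumed to be globally Lipschitz continuous; finite-valued convex functions are Lipschitz continuous on bounded sets.
   Formalization: The constant L is taken to be a common Lipschitz constant on A' of all component functions f_i, not merely of f; with the Lipschitz constant of f alone the bound can fail. *)

theory Defs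
  imports "HOL-Probability.Probability"
begin

definition subdifferential :: "('a::real_inner \<Rightarrow> real) \<Rightarrow> 'a \<Rightarrow> 'a set" where
  "subdifferential h x = {g. \<forall>y. h y \<ge> h x + g \<bullet> (y - x)}"

definition minimizers :: "('a \<Rightarrow> real) \<Rightarrow> 'a set" where
  "minimizers h = {x. is_arg_min h (\<lambda>_. True) x}"

text \<open>If \<open>f\<close> is the average of the \<open>F i\<close>, one common minimizer suffices: the excess of \<open>f\<close> over its
  minimum is then an average of nonnegative excesses, so every minimizer of \<open>f\<close> minimizes each
  \<open>F i\<close>.\<close>

definition interpolation :: "('a \<Rightarrow> real) \<Rightarrow> nat \<Rightarrow> (nat \<Rightarrow> 'a \<Rightarrow> real) \<Rightarrow> bool" where
  "interpolation f n F \<longleftrightarrow> (\<exists>z \<in> minimizers f. \<forall>i\<in>{1..n}. z \<in> minimizers (F i))"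

end

theory Submission
  imports Defs
begin

text \<open>
  By interpolation, every component is minimized at \<open>xs\<close>, so each normalized step satisfies
  \<open>|x(k+1) - xs|^2 \<le> |x k - xs|^2 - 2 b / L (F i (x k) - F i xs) + b^2\<close> with \<open>b = c / sqrt (T + 1)\<close>,
  whichever index \<open>i\<close> was drawn. Hence the iterates almost surely never leave the ball contained in
  \<open>A'\<close>, where subgradients have norm at most \<open>L\<close>. Summing up, taking expectations (the
  index drawn in step \<open>k\<close> is independent of \<open>x k\<close>) and applying Jensen's inequality gives the bound.
\<close>

lemma mem_minimizers_iff:
  fixes h :: "'a \<Rightarrow> real"
  shows "z \<in> minimizers h \<longleftrightarrow> (\<forall>y. h z \<le> h y)"
  by (simp add: minimizers_def is_arg_min_linorder)

text \<open>Carries interpolation from the one common minimizer \<open>z\<close> over to the fixed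
  \<open>xs\<close>: the component excesses over their values at \<open>z\<close> are nonnegative
  and sum to zero at \<open>xs\<close>, so each vanishes.\<close>

lemma interpolation_minimizes_components:
  fixes F :: "nat \<Rightarrow> 'a \<Rightarrow> real"
  assumes "n \<ge> 1"
    and f: "f = (\<lambda>y. (1 / real n) * (\<Sum>i=1..n. F i y))"
    and "interpolation f n F" and xs: "xs \<in> minimizers f" and i: "i \<in> {1..n}"
  shows "F i xs \<le> F i y"
proof -
  obtain z where z: "z \<in> minimizers f" "\<And>i. i \<in> {1..n} \<Longrightarrow> z \<in> minimizers (F i)"
    using assms(3) unfolding interpolation_def by blast
  have "f xs = f z"
    using z(1) xs by (simp add: mem_minimizers_iff order_antisym)
  then have "(\<Sum>i=1..n. F i xs - F i z) = 0"
    using \<open>n \<ge> 1\<close> unfolding f by (simp add: sum_subtractf)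
  moreover have "\<And>i. i \<in> {1..n} \<Longrightarrow> 0 \<le> F i xs - F i z"
    using z(2) by (simp add: mem_minimizers_iff)
  ultimately have "F i xs - F i z = 0"
    using i by (subst (asm) sum_nonneg_eq_0_iff) auto
  then show ?thesis
    using z(2)[OF i] by (simp add: mem_minimizers_iff)
qed

text \<open>Test the subgradient inequality a short step \<open>t\<close> in the direction of
  \<open>v\<close> itself: \<open>h\<close> grows by at least \<open>t * |v|^2\<close>, while the
  Lipschitz condition allows at most \<open>L * t * |v|\<close>. Openness leaves room for the
  step.\<close>

lemma norm_subgradient_le_lipschitz:
  fixes h :: "'a::real_inner \<Rightarrow> real"
  assumes "open A" "y \<in> A" "L-lipschitz_on A h" "v \<in> subdifferential h y"
  shows "norm v \<le> L"
proof (cases "v = 0")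
  case True
  then show ?thesis
    using assms(3) lipschitz_on_nonneg by auto
next
  case False
  obtain e where e: "e > 0" "ball y e \<subseteq> A"
    using assms(1,2) openE by blast
  \<comment> \<open>The displacement \<open>t *\<^sub>R v\<close> then has norm
    \<open>e / 2\<close>, inside the ball.\<close>
  define t where "t = e / 2 / norm v"
  have t: "t > 0" "t * norm v < e"
    using e False by (auto simp: t_def)
  have "y + t *\<^sub>R v \<in> ball y e"
    using t by (simp add: dist_norm)
  then have "\<bar>h (y + t *\<^sub>R v) - h y\<bar> \<le> L * (t * norm v)"
    using lipschitz_on_normD[OF assms(3), of "y + t *\<^sub>R v" y] e t assms(2) by auto
  moreover have "h (y + t *\<^sub>R v) \<ge> h y + v \<bullet> ((y + t *\<^sub>R v) - y)"
    using assms(4) unfolding subdifferential_def by blast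
  ultimately have "t * norm v * norm v \<le> t * norm v * L"
    by (simp add: power2_norm_eq_inner[symmetric] power2_eq_square algebra_simps)
  then show ?thesis
    using t False by simp
qed

text \<open>Expand the square. Normalization makes the last term exactly \<open>b^2\<close>; the
  subgradient inequality bounds the inner product below by the excess of \<open>h\<close>. That
  excess is nonnegative, so \<open>norm v\<close> may be replaced by the larger
  \<open>L\<close>.\<close>

lemma normalized_subgradient_step:
  fixes h :: "'a::real_inner \<Rightarrow> real"
  assumes v: "v \<in> subdifferential h y" "norm v \<le> L"
    and "L > 0" "b \<ge> 0" and min: "\<And>w. h xs \<le> h w"
  shows "(norm (y - (b / norm v) *\<^sub>R v - xs))\<^sup>2 \<le> (norm (y - xs))\<^sup>2 - 2 * b / L * (h y - h xs) + b\<^sup>2"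
proof -
  have sub: "h xs \<ge> h y + v \<bullet> (xs - y)"
    using v(1) unfolding subdifferential_def by blast
  show ?thesis
  proof (cases "v = 0")
    case True \<comment> \<open>the step is zero, as \<open>b / 0 = 0\<close>\<close>
    then have "h y = h xs"
      using sub min[of y] by simp
    then show ?thesis
      using True by simp
  next
    case False
    have "b / L * (h y - h xs) \<le> b / norm v * (h y - h xs)"
      using False v(2) \<open>L > 0\<close> \<open>b \<ge> 0\<close> min[of y]
      by (intro mult_right_mono divide_left_mono) auto
    also have "\<dots> \<le> b / norm v * (v \<bullet> (y - xs))"
      using sub \<open>b \<ge> 0\<close> by (intro mult_left_mono) (auto simp: inner_diff_right)
    finally have le: "b / L * (h y - h xs) \<le> b / norm v * (v \<bullet> (y - xs))" .
    have "(norm (y - (b / norm v) *\<^sub>R v - xs))\<^sup>2 = (norm ((y - xs) - (b / norm v) *\<^sub>R v))\<^sup>2"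
      by (simp add: algebra_simps)
    also have "\<dots> = (norm (y - xs))\<^sup>2 - 2 * (b / norm v * (v \<bullet> (y - xs))) + (norm ((b / norm v) *\<^sub>R v))\<^sup>2"
      using power2_norm_eq_inner[of "(y - xs) - (b / norm v) *\<^sub>R v"]
      by (simp only: power2_norm_eq_inner inner_diff_left inner_diff_right)
        (simp add: inner_commute diff_divide_distrib right_diff_distrib)
    also have "(norm ((b / norm v) *\<^sub>R v))\<^sup>2 = b\<^sup>2"
      using False \<open>b \<ge> 0\<close> by simp
    finally show ?thesis
      using le by simp
  qed
qed

text \<open>The single-step bounds telescope, but each requires \<open>norm (v k) \<le> L\<close>,
  which is available only inside \<open>A\<close>. One induction therefore yields both the estimate
  and the confinement of the path.\<close>

lemma normalized_subgradient_path:
  fixes y v :: "nat \<Rightarrow> 'a::real_inner" and h :: "nat \<Rightarrow> 'a \<Rightarrow> real"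
  assumes v: "\<And>k. k < N \<Longrightarrow> v k \<in> subdifferential (h k) (y k)"
    and step: "\<And>k. k < N \<Longrightarrow> y (Suc k) = y k - (b / norm (v k)) *\<^sub>R v k"
    and min: "\<And>k w. k < N \<Longrightarrow> h k xs \<le> h k w"
    and A: "open A" "{w. (norm (w - xs))\<^sup>2 \<le> (norm (y 0 - xs))\<^sup>2 + N * b\<^sup>2} \<subseteq> A"
    and lip: "\<And>k. k < N \<Longrightarrow> L-lipschitz_on A (h k)"
    and "L > 0" "b \<ge> 0" "k \<le> N"
  shows "(norm (y k - xs))\<^sup>2 + 2 * b / L * (\<Sum>j<k. h j (y j) - h j xs) \<le> (norm (y 0 - xs))\<^sup>2 + k * b\<^sup>2"
  using \<open>k \<le> N\<close>
proof (induction k)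
  case 0
  then show ?case by simp
next
  case (Suc k)
  then have k: "k < N" by simp
  \<comment> \<open>Dropping this sum from the induction hypothesis leaves the distance bound that
    puts \<open>y k\<close> in the ball.\<close>
  have "0 \<le> 2 * b / L * (\<Sum>j<k. h j (y j) - h j xs)"
    using min k \<open>L > 0\<close> \<open>b \<ge> 0\<close> by (intro mult_nonneg_nonneg sum_nonneg) auto
  moreover have "k * b\<^sup>2 \<le> N * b\<^sup>2"
    using k by (intro mult_right_mono) auto
  ultimately have "y k \<in> A"
    using Suc A(2) by auto
  then have "norm (v k) \<le> L"
    by (rule norm_subgradient_le_lipschitz[OF A(1) _ lip[OF k] v[OF k]])
  then have "(norm (y (Suc k) - xs))\<^sup>2 \<le> (norm (y k - xs))\<^sup>2 - 2 * b / L * (h k (y k) - h k xs) + b\<^sup>2"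
    using normalized_subgradient_step[OF v[OF k] _ \<open>L > 0\<close> \<open>b \<ge> 0\<close>, of xs] min[OF k] step[OF k]
    by simp
  then show ?case
    using Suc by (simp add: algebra_simps)
qed

text \<open>The selection \<open>g\<close> of subgradients need not be measurable, but the history of drawn
  indices takes only countably many values, so the iterates are measurable functions of it.\<close>

lemma measurable_function_of_history:
  fixes I :: "'i \<Rightarrow> 'w \<Rightarrow> 'n::countable"
  assumes "finite K" "\<And>j. j \<in> K \<Longrightarrow> I j \<in> M \<rightarrow>\<^sub>M count_space UNIV"
    and "space N = UNIV"
  shows "\<Phi> \<in> Pi\<^sub>M K (\<lambda>_. count_space (UNIV :: 'n set)) \<rightarrow>\<^sub>M N"
    and "(\<lambda>\<omega>. \<Phi> (restrict (\<lambda>j. I j \<omega>) K)) \<in> M \<rightarrow>\<^sub>M N"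
proof -
  \<comment> \<open>A finite product of countable discrete spaces is discrete, so every function on
    it is measurable.\<close>
  show \<Phi>: "\<Phi> \<in> Pi\<^sub>M K (\<lambda>_. count_space (UNIV :: 'n set)) \<rightarrow>\<^sub>M N"
    using assms(1,3) by (subst count_space_PiM_finite) auto
  show "(\<lambda>\<omega>. \<Phi> (restrict (\<lambda>j. I j \<omega>) K)) \<in> M \<rightarrow>\<^sub>M N"
    by (rule measurable_compose[OF _ \<Phi>]) (auto intro!: measurable_restrict assms(2))
qed

text \<open>Takes the place of conditioning on the past: the draw at step \<open>k\<close> and the
  earlier draws are blocks of an independent family over disjoint index sets, so the expectation
  factors.\<close>

lemma (in prob_space) expectation_indicator_history:
  fixes I :: "nat \<Rightarrow> 'a \<Rightarrow> 'n::countable" and \<Phi> :: "(nat \<Rightarrow> 'n) \<Rightarrow> real"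
  assumes indep: "indep_vars (\<lambda>_. count_space UNIV) I {..T}" and "k \<le> T"
    and int: "integrable M (\<lambda>\<omega>. \<Phi> (restrict (\<lambda>j. I j \<omega>) {..<k}))"
  shows "integrable M (\<lambda>\<omega>. indicator {i} (I k \<omega>) * \<Phi> (restrict (\<lambda>j. I j \<omega>) {..<k}))"
    and "expectation (\<lambda>\<omega>. indicator {i} (I k \<omega>) * \<Phi> (restrict (\<lambda>j. I j \<omega>) {..<k}))
      = measure (distr M (count_space UNIV) (I k)) {i}
        * expectation (\<lambda>\<omega>. \<Phi> (restrict (\<lambda>j. I j \<omega>) {..<k}))"
proof -
  let ?X = "\<lambda>\<omega>. indicator {i} (I k \<omega>) :: real"
  let ?Y = "\<lambda>\<omega>. \<Phi> (restrict (\<lambda>j. I j \<omega>) {..<k})"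
  have meas: "I j \<in> M \<rightarrow>\<^sub>M count_space UNIV" if "j \<le> T" for j
    using indep that by (auto simp: indep_vars_def)
  note meask [measurable] = meas[OF \<open>k \<le> T\<close>]
  have "indep_var (Pi\<^sub>M {k} (\<lambda>_. count_space UNIV)) (\<lambda>\<omega>. restrict (\<lambda>j. I j \<omega>) {k})
      (Pi\<^sub>M {..<k} (\<lambda>_. count_space UNIV)) (\<lambda>\<omega>. restrict (\<lambda>j. I j \<omega>) {..<k})"
    using \<open>k \<le> T\<close> by (intro indep_var_restrict[OF indep]) auto
  from indep_var_compose[OF this, of "\<lambda>v. indicator {i} (v k)" borel \<Phi> borel]
  have ind: "indep_var borel ?X borel ?Y"
    using \<open>k \<le> T\<close> meas measurable_function_of_history(1)[where M = M and I = I and K = "{k}" and N = borel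
        and \<Phi> = "\<lambda>v. indicator {i} (v k) :: real"]
      measurable_function_of_history(1)[where M = M and I = I and K = "{..<k}" and N = borel and \<Phi> = \<Phi>]
    by (simp add: comp_def)
  have intX: "integrable M ?X"
    by (rule integrable_const_bound[where B = 1]) auto
  show "integrable M (\<lambda>\<omega>. ?X \<omega> * ?Y \<omega>)"
    by (rule indep_var_integrable[OF ind intX int])
  have "expectation ?X = integral\<^sup>L (distr M (count_space UNIV) (I k)) (indicator {i})"
    by (rule integral_distr[symmetric]) auto
  also have "\<dots> = measure (distr M (count_space UNIV) (I k)) {i}"
    by simp
  finally show "expectation (\<lambda>\<omega>. ?X \<omega> * ?Y \<omega>)
      = measure (distr M (count_space UNIV) (I k)) {i} * expectation ?Y"
    by (simp add: indep_var_lebesgue_integral[OF ind intX int])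
qed

text \<open>\<open>L\<close> is a constant for every component because the argument bounds the drawn
  subgradients, and a subgradient of a single \<open>F i\<close> can be longer than the Lipschitz
  constant of the average \<open>f\<close>. Integrability is asserted explicitly since the integral
  of a non-integrable function is 0 by convention.\<close>

theorem corollary4:
  fixes f :: "real ^ 'd \<Rightarrow> real"
    and F :: "nat \<Rightarrow> real ^ 'd \<Rightarrow> real"
    and n T :: nat
    and g :: "nat \<Rightarrow> real ^ 'd \<Rightarrow> real ^ 'd"
    and M :: "'w measure"
    and I :: "nat \<Rightarrow> 'w \<Rightarrow> nat"
    and x :: "nat \<Rightarrow> 'w \<Rightarrow> real ^ 'd"
    and x0 xs :: "real ^ 'd"
    and \<alpha> :: "nat \<Rightarrow> 'w \<Rightarrow> real"
    and \<beta> :: "nat \<Rightarrow> real"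
    and c L :: real
    and A' :: "(real ^ 'd) set"
  assumes n_pos: "n \<ge> 1"
    and finite_sum: "f = (\<lambda>y. (1 / real n) * (\<Sum>i=1..n. F i y))"
    and convex: "\<And>i. i \<in> {1..n} \<Longrightarrow> convex_on UNIV (F i)"
    and interpolation: "interpolation f n F"
    and optimal: "xs \<in> minimizers f"
    and prob: "prob_space M"
    and indep: "prob_space.indep_vars M (\<lambda>_. count_space UNIV) I {..T}"
    and uniform: "\<And>k. k \<le> T \<Longrightarrow>
                    distr M (count_space UNIV) (I k) = measure_pmf (pmf_of_set {1..n})"
    and subgrad: "\<And>i y. i \<in> {1..n} \<Longrightarrow> g i y \<in> subdifferential (F i) y"
    and init: "\<And>\<omega>. \<omega> \<in> space M \<Longrightarrow> x 0 \<omega> = x0"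
    and step: "\<And>k \<omega>. k \<le> T \<Longrightarrow> \<omega> \<in> space M \<Longrightarrow>
                 x (Suc k) \<omega> = x k \<omega> - \<alpha> k \<omega> *\<^sub>R g (I k \<omega>) (x k \<omega>)"
    and stepsize: "\<And>k \<omega>. k \<le> T \<Longrightarrow> \<omega> \<in> space M \<Longrightarrow>
                     \<alpha> k \<omega> = \<beta> k / norm (g (I k \<omega>) (x k \<omega>))"
    and beta: "\<And>k. k \<le> T \<Longrightarrow> \<beta> k = c / sqrt (real T + 1)"
    and c_pos: "c > 0"
    and A': "bounded A'" "open A'" "convex A'"
            "{y. (norm (y - xs))\<^sup>2 \<le> (norm (x0 - xs))\<^sup>2 + c\<^sup>2} \<subseteq> A'"
    and L_pos: "L > 0"
    and lipschitz: "\<And>i. i \<in> {1..n} \<Longrightarrow> L-lipschitz_on A' (F i)"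
  shows "integrable M (\<lambda>\<omega>. f ((1 / (real T + 1)) *\<^sub>R (\<Sum>k=0..T. x k \<omega>)) - (INF y. f y)) \<and>
         (LINT \<omega>|M. f ((1 / (real T + 1)) *\<^sub>R (\<Sum>k=0..T. x k \<omega>)) - (INF y. f y))
           \<le> L * ((norm (x0 - xs))\<^sup>2 / c + c) / (2 * sqrt (real T + 1))"
proof -
  interpret prob_space M by (rule prob)
  define b where "b = c / sqrt (real T + 1)"
  define D where "D = (norm (x0 - xs))\<^sup>2"
  \<comment> \<open>The radius of the ball assumed to lie in \<open>A'\<close>.\<close>
  define R where "R = sqrt (D + c\<^sup>2)"
  \<comment> \<open>Uniformity confines the indices to \<open>{1..n}\<close> only almost surely; the
    pathwise arguments run on this event.\<close>
  define good where "good \<omega> \<longleftrightarrow> (\<forall>k\<le>T. I k \<omega> \<in> {1..n})" for \<omega>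
  define xt where "xt \<omega> = (1 / (real T + 1)) *\<^sub>R (\<Sum>k=0..T. x k \<omega>)" for \<omega>
  \<comment> \<open>The excess of the drawn component, split over the possible indices so that
    independence applies to each term with \<open>i\<close> fixed.\<close>
  define e where "e k \<omega> = (\<Sum>i=1..n. indicator {i} (I k \<omega>) * (F i (x k \<omega>) - F i xs))" for k \<omega>
  \<comment> \<open>The \<open>T + 1\<close> steps add at most \<open>c^2\<close> to the squared
    distance, which is the slack of the ball in \<open>A'\<close>.\<close>
  have b: "b > 0" "(real T + 1) * b\<^sup>2 = c\<^sup>2"
    using c_pos by (auto simp: b_def power_divide)
  have Fmin: "F i xs \<le> F i y" if "i \<in> {1..n}" for i y
    using interpolation_minimizes_components[OF n_pos finite_sum interpolation optimal that] .
  have fmin: "f xs \<le> f y" for y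
    using optimal by (simp add: mem_minimizers_iff)
  have Inf: "(INF y. f y) = f xs"
    using fmin by (intro cInf_eq_minimum) auto
  have f_diff: "f y - f xs = (1 / real n) * (\<Sum>i=1..n. F i y - F i xs)" for y
    by (simp add: finite_sum sum_subtractf algebra_simps)
  have f_convex: "convex_on UNIV f"
  proof -
    have "convex_on UNIV (\<lambda>y. \<Sum>i\<in>S. F i y)" if "finite S" "S \<subseteq> {1..n}" for S
      using that by (induction S) (auto intro!: convex_on_add convex simp: convex_on_const)
    then show ?thesis
      unfolding finite_sum by (intro convex_on_cmul) auto
  qed

  \<comment> \<open>Range of the sampled indices\<close>
  have I_meas: "I k \<in> M \<rightarrow>\<^sub>M count_space UNIV" if "k \<le> T" for k
    using indep that by (auto simp: indep_vars_def)
  have AE_I: "AE \<omega> in M. I k \<omega> \<in> {1..n}" if "k \<le> T" for k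
  proof -
    have "AE i in distr M (count_space UNIV) (I k). i \<in> {1..n}"
      unfolding uniform[OF that] AE_measure_pmf_iff using n_pos by simp
    then show ?thesis
      using I_meas[OF that] by (simp add: AE_distr_iff)
  qed
  have AE_good: "AE \<omega> in M. good \<omega>"
    using AE_I unfolding good_def by (simp add: AE_all_countable)

  \<comment> \<open>Pathwise bounds on the iterates\<close>
  have x_step: "x (Suc k) \<omega> = x k \<omega> - (b / norm (g (I k \<omega>) (x k \<omega>))) *\<^sub>R g (I k \<omega>) (x k \<omega>)"
    if "k \<le> T" "\<omega> \<in> space M" for k \<omega>
    using step stepsize beta that by (simp add: b_def)
  \<comment> \<open>The range includes \<open>x (Suc T)\<close>, which is not averaged, since only
    there does the sum cover all steps up to \<open>T\<close>.\<close>
  have path: "(norm (x k \<omega> - xs))\<^sup>2 + 2 * b / L * (\<Sum>j<k. F (I j \<omega>) (x j \<omega>) - F (I j \<omega>) xs)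
      \<le> D + k * b\<^sup>2"
    if "k \<le> Suc T" "\<omega> \<in> space M" "good \<omega>" for k \<omega>
    using normalized_subgradient_path[where N = "Suc T" and y = "\<lambda>k. x k \<omega>" and b = b and xs = xs
        and v = "\<lambda>k. g (I k \<omega>) (x k \<omega>)" and h = "\<lambda>k. F (I k \<omega>)" and A = A' and L = L and k = k]
      that b A'(2,4) L_pos Fmin subgrad lipschitz x_step init
    by (auto simp: D_def good_def less_Suc_eq_le add.commute)
  have in_ball: "norm (x k \<omega> - xs) \<le> R" if "k \<le> T" "\<omega> \<in> space M" "good \<omega>" for k \<omega>
  proof -
    have "0 \<le> 2 * b / L * (\<Sum>j<k. F (I j \<omega>) (x j \<omega>) - F (I j \<omega>) xs)"
      using Fmin b L_pos that by (intro mult_nonneg_nonneg sum_nonneg) (auto simp: good_def)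
    moreover have "k * b\<^sup>2 \<le> (real T + 1) * b\<^sup>2"
      using that by (intro mult_right_mono) auto
    ultimately have "(norm (x k \<omega> - xs))\<^sup>2 \<le> D + c\<^sup>2"
      using path[of k \<omega>] that b by simp
    then show ?thesis
      unfolding R_def by (rule real_le_rsqrt)
  qed
  \<comment> \<open>A uniform bound on the ball, used for integrability.\<close>
  have F_bound: "\<bar>F i y - F i xs\<bar> \<le> L * R" if "i \<in> {1..n}" "norm (y - xs) \<le> R" for i y
  proof -
    have "(norm (y - xs))\<^sup>2 \<le> R\<^sup>2"
      using that by (intro power_mono) auto
    then have "y \<in> A'"
      using A'(4) by (auto simp: R_def D_def)
    moreover have "xs \<in> A'"
      using A'(4) by auto
    ultimately have "\<bar>F i y - F i xs\<bar> \<le> L * norm (y - xs)"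
      using lipschitz_on_normD[OF lipschitz[OF that(1)]] by auto
    also have "\<dots> \<le> L * R"
      using that L_pos by simp
    finally show ?thesis .
  qed

  \<comment> \<open>Iterates as functions of the earlier draws\<close>
  have history: "\<exists>h. \<forall>\<omega>\<in>space M. x k \<omega> = h (restrict (\<lambda>j. I j \<omega>) {..<k})" if "k \<le> T" for k
    using that
  proof (induction k)
    case 0
    then show ?case
      using init by (intro exI[of _ "\<lambda>_. x0"]) simp
  next
    case (Suc k)
    then obtain h where h: "\<And>\<omega>. \<omega> \<in> space M \<Longrightarrow> x k \<omega> = h (restrict (\<lambda>j. I j \<omega>) {..<k})"
      using Suc_leD by blast
    \<comment> \<open>The conditional is \<open>restrict u {..<Suc k}\<close> written out: cutting
      the longer history back to \<open>k\<close> draws recovers the shorter one.\<close>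
    have "restrict (\<lambda>j. if j < Suc k then u j else undefined) {..<k} = restrict u {..<k}" for u :: "nat \<Rightarrow> nat"
      by (auto simp: restrict_def)
    then show ?case
      using h x_step[of k] Suc.prems
      by (intro exI[of _ "\<lambda>v. h (restrict v {..<k})
            - (b / norm (g (v k) (h (restrict v {..<k})))) *\<^sub>R g (v k) (h (restrict v {..<k}))"])
        simp
  qed
  have x_meas [measurable]: "x k \<in> borel_measurable M" if "k \<le> T" for k
  proof -
    obtain h where h: "\<And>\<omega>. \<omega> \<in> space M \<Longrightarrow> x k \<omega> = h (restrict (\<lambda>j. I j \<omega>) {..<k})"
      using history[OF \<open>k \<le> T\<close>] by blast
    have "(\<lambda>\<omega>. h (restrict (\<lambda>j. I j \<omega>) {..<k})) \<in> borel_measurable M"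
      using I_meas that by (intro measurable_function_of_history(2)) auto
    then show ?thesis
      using h by (subst measurable_cong)
  qed

  \<comment> \<open>Measurability and integrability of the excesses\<close>
  have continuous: "continuous_on UNIV f"
    using convex_on_continuous[OF open_UNIV f_convex] .
  have f_meas [measurable]: "f \<in> borel_measurable borel"
    using continuous by (rule borel_measurable_continuous_onI)
  have F_meas [measurable]: "F i \<in> borel_measurable borel" if "i \<in> {1..n}" for i
    using convex_on_continuous[OF open_UNIV convex[OF that]] by (rule borel_measurable_continuous_onI)
  have F_int: "integrable M (\<lambda>\<omega>. F i (x k \<omega>) - F i xs)" if "i \<in> {1..n}" "k \<le> T" for i k
  proof (rule integrable_const_bound[where B = "L * R"])
    show "AE \<omega> in M. norm (F i (x k \<omega>) - F i xs) \<le> L * R"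
      using AE_good AE_space by eventually_elim (use F_bound in_ball that in auto)
  qed (use that in measurable)
  have f_int: "integrable M (\<lambda>\<omega>. f (x k \<omega>) - f xs)" if "k \<le> T" for k
    unfolding f_diff
    by (intro integrable_mult_right Bochner_Integration.integrable_sum F_int that)

  \<comment> \<open>Each index has probability \<open>1 / n\<close> independently of
    \<open>x k\<close>, so in expectation the drawn excess equals the excess of
    \<open>f\<close>.\<close>
  have e_int: "integrable M (e k)" and e_exp: "expectation (e k) = expectation (\<lambda>\<omega>. f (x k \<omega>) - f xs)"
    if "k \<le> T" for k
  proof -
    obtain h where h: "\<And>\<omega>. \<omega> \<in> space M \<Longrightarrow> x k \<omega> = h (restrict (\<lambda>j. I j \<omega>) {..<k})"
      using history[OF \<open>k \<le> T\<close>] by blast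
    have int: "integrable M (\<lambda>\<omega>. indicator {i} (I k \<omega>) * (F i (x k \<omega>) - F i xs))" (is ?int)
      and exp: "expectation (\<lambda>\<omega>. indicator {i} (I k \<omega>) * (F i (x k \<omega>) - F i xs))
        = (1 / real n) * expectation (\<lambda>\<omega>. F i (x k \<omega>) - F i xs)" (is ?exp)
      if i: "i \<in> {1..n}" for i
    proof -
      let ?\<Phi> = "\<lambda>v. F i (h v) - F i xs"
      \<comment> \<open>The free factor \<open>u\<close> covers both the indicator weight and, with
        \<open>u\<close> constantly 1, the plain integrand.\<close>
      have eq: "integrable M (\<lambda>\<omega>. u \<omega> * ?\<Phi> (restrict (\<lambda>j. I j \<omega>) {..<k}))
            \<longleftrightarrow> integrable M (\<lambda>\<omega>. u \<omega> * (F i (x k \<omega>) - F i xs))"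
          "expectation (\<lambda>\<omega>. u \<omega> * ?\<Phi> (restrict (\<lambda>j. I j \<omega>) {..<k}))
            = expectation (\<lambda>\<omega>. u \<omega> * (F i (x k \<omega>) - F i xs))" for u
        using h by (auto intro!: Bochner_Integration.integrable_cong Bochner_Integration.integral_cong)
      have "integrable M (\<lambda>\<omega>. ?\<Phi> (restrict (\<lambda>j. I j \<omega>) {..<k}))"
        using F_int[OF i \<open>k \<le> T\<close>] eq(1)[of "\<lambda>_. 1"] by simp
      note E = expectation_indicator_history[OF indep \<open>k \<le> T\<close> this, of i]
      show ?int
        using E(1) unfolding eq(1) .
      have "measure (distr M (count_space UNIV) (I k)) {i} = 1 / real n"
        using i n_pos by (simp add: uniform[OF \<open>k \<le> T\<close>] measure_pmf_of_set)
      then show ?exp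
        using E(2) unfolding eq(2) eq(2)[of "\<lambda>_. 1", unfolded mult_1] by simp
    qed
    show "integrable M (e k)"
      unfolding e_def by (intro Bochner_Integration.integrable_sum int)
    have "expectation (e k) = (\<Sum>i=1..n. (1 / real n) * expectation (\<lambda>\<omega>. F i (x k \<omega>) - F i xs))"
      unfolding e_def using int exp by (subst Bochner_Integration.integral_sum) auto
    also have "\<dots> = expectation (\<lambda>\<omega>. f (x k \<omega>) - f xs)"
      unfolding f_diff using F_int[OF _ that]
      by (subst integral_mult_right_zero, subst Bochner_Integration.integral_sum)
        (auto simp: sum_distrib_left)
    finally show "expectation (e k) = expectation (\<lambda>\<omega>. f (x k \<omega>) - f xs)" .
  qed

  \<comment> \<open>On \<open>good\<close> the indicators pick out exactly the drawn component, so
    the path bound at \<open>Suc T\<close> applies; its squared distance is dropped.\<close>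
  have sum_e: "(\<Sum>k=0..T. e k \<omega>) \<le> L / (2 * b) * (D + c\<^sup>2)" if "\<omega> \<in> space M" "good \<omega>" for \<omega>
  proof -
    have "e k \<omega> = F (I k \<omega>) (x k \<omega>) - F (I k \<omega>) xs" if "k \<le> T" for k
    proof -
      have "e k \<omega> = (\<Sum>i=1..n. if i = I k \<omega> then F i (x k \<omega>) - F i xs else 0)"
        unfolding e_def by (intro sum.cong) (auto simp: indicator_def)
      then show ?thesis
        using \<open>good \<omega>\<close> that by (auto simp: good_def)
    qed
    then have "(\<Sum>k=0..T. e k \<omega>) = (\<Sum>j<Suc T. F (I j \<omega>) (x j \<omega>) - F (I j \<omega>) xs)"
      by (intro sum.cong) auto
    moreover have "(norm (x (Suc T) \<omega> - xs))\<^sup>2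
        + 2 * b / L * (\<Sum>j<Suc T. F (I j \<omega>) (x j \<omega>) - F (I j \<omega>) xs) \<le> D + c\<^sup>2"
      using path[of "Suc T" \<omega>] that b by (simp add: add.commute)
    then have "2 * b / L * (\<Sum>j<Suc T. F (I j \<omega>) (x j \<omega>) - F (I j \<omega>) xs) \<le> D + c\<^sup>2"
      using zero_le_power2[of "norm (x (Suc T) \<omega> - xs)"] by linarith
    ultimately have "2 * b / L * (\<Sum>k=0..T. e k \<omega>) \<le> D + c\<^sup>2"
      by (simp only:)
    then show ?thesis
      using b(1) L_pos by (simp add: field_simps)
  qed

  \<comment> \<open>The averaged iterate\<close>
  have weight: "(\<Sum>k=0..T. 1 / (real T + 1)) = 1"
    by (simp add: field_simps)
  have jensen: "f (xt \<omega>) - f xs \<le> (1 / (real T + 1)) * (\<Sum>k=0..T. f (x k \<omega>) - f xs)" for \<omega>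
  proof -
    have "f (xt \<omega>) \<le> (\<Sum>k=0..T. (1 / (real T + 1)) * f (x k \<omega>))"
      unfolding xt_def scaleR_sum_right
      using convex_on_sum[OF _ _ f_convex weight] by auto
    also have "\<dots> = (1 / (real T + 1)) * (\<Sum>k=0..T. f (x k \<omega>) - f xs)
        + (\<Sum>k=0..T. 1 / (real T + 1)) * f xs"
      by (simp only: sum_distrib_left sum_distrib_right right_diff_distrib sum_subtractf)
    finally show ?thesis
      unfolding weight by simp
  qed
  have avg_int: "integrable M (\<lambda>\<omega>. (1 / (real T + 1)) * (\<Sum>k=0..T. f (x k \<omega>) - f xs))"
    by (intro integrable_mult_right Bochner_Integration.integrable_sum f_int) simp
  have xt_meas [measurable]: "xt \<in> borel_measurable M"
    unfolding xt_def using x_meas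
    by (intro borel_measurable_scaleR borel_measurable_const borel_measurable_sum) auto
  \<comment> \<open>Minimality of \<open>xs\<close> and Jensen's inequality place the integrand
    between zero and an integrable average.\<close>
  have xt_int: "integrable M (\<lambda>\<omega>. f (xt \<omega>) - f xs)"
    using avg_int
  proof (rule Bochner_Integration.integrable_bound)
    show "AE \<omega> in M. norm (f (xt \<omega>) - f xs)
        \<le> norm ((1 / (real T + 1)) * (\<Sum>k=0..T. f (x k \<omega>) - f xs))"
    proof (rule AE_I2)
      fix \<omega>
      show "norm (f (xt \<omega>) - f xs) \<le> norm ((1 / (real T + 1)) * (\<Sum>k=0..T. f (x k \<omega>) - f xs))"
        using jensen[of \<omega>] fmin[of "xt \<omega>"] by (smt (verit) real_norm_def)
    qed
  qed measurable

  \<comment> \<open>Final estimate\<close>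
  have "expectation (\<lambda>\<omega>. f (xt \<omega>) - f xs)
      \<le> expectation (\<lambda>\<omega>. (1 / (real T + 1)) * (\<Sum>k=0..T. f (x k \<omega>) - f xs))"
    using xt_int avg_int jensen by (rule integral_mono)
  also have "\<dots> = (1 / (real T + 1)) * expectation (\<lambda>\<omega>. \<Sum>k=0..T. e k \<omega>)"
    using f_int e_int e_exp by (simp add: Bochner_Integration.integral_sum)
  also have "\<dots> \<le> (1 / (real T + 1)) * (L / (2 * b) * (D + c\<^sup>2))"
  proof (intro mult_left_mono integral_le_const)
    show "AE \<omega> in M. (\<Sum>k=0..T. e k \<omega>) \<le> L / (2 * b) * (D + c\<^sup>2)"
      using AE_good AE_space by eventually_elim (rule sum_e)
  qed (use e_int in auto)
  also have "\<dots> = L * (D / c + c) / (2 * sqrt (real T + 1))"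
  proof -
    \<comment> \<open>With \<open>T + 1 = s * s\<close> and \<open>b = c / s\<close> no square root
      remains, and the identity is field arithmetic.\<close>
    define s where "s = sqrt (real T + 1)"
    have "real T + 1 = s * s" "s > 0" "b = c / s"
      by (auto simp: s_def b_def)
    then show ?thesis
      using c_pos unfolding s_def[symmetric] by (simp add: field_simps power2_eq_square)
  qed
  finally show ?thesis
    using xt_int unfolding Inf xt_def D_def by simp
qed

end
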